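(* Let $A=(a_{u,v})$ be an $n\times n$ Robinson matrix with entries in $\{0,1,\dots,k\}$ and all diagonal entries equal to $k$. Then $A$ has a uniform embedding if and only if there exists $\mathbf d\in\mathbb D^k$ such that for all $u,v\in[n]$ with $u<v$, for every $(u,v)$-upper-bound-path $W_1$ and every $(u,v)$-lower-bound-path $W_2$, $$\beta^-(W_2)^\top\mathbf d<\beta^+(W_1)^\top\mathbf d.$$
   Context: $[n]=\{1,\dots,n\}$. A Robinson matrix is a symmetric matrix $(a_{i,j})$ such that for all $u<v<w$, $a_{u,v}\ge a_{u,w}$ and $a_{v,w}\ge a_{u,w}$. $\mathbb D^k=\{\mathbf d\in\mathbb R^k: d_1>\dots>d_k>0\}$. A uniform embedding of $A$ with respect to $\mathbf d\in\mathbb D^k$ is a map $\Pi:[n]\to\mathbb R$ such that for all $u,v\in[n]$ and $t\in\{0,\dots,k\}$: $a_{u,v}=t\iff d_{t+1}<|\Pi(v)-\Pi(u)|\le d_t$ (with $d_{k+1}=-\infty$, $d_0=\infty$); $A$ has a uniform embedding if one exists for some $\mathbf d\in\mathbb D^k$. Let $\chi_i\in\mathbb Z^k$ be the $i$-th unit vector. For $u<v$: $\beta^+(u,v)=\chi_t$ if $a_{u,v}=t\ge1$ (undefined if $a_{u,v}=0$); $\beta^-(u,v)=\chi_{t+1}$ if $a_{u,v}=t\le k-1$ and $\beta^-(u,v)=\mathbf 0$ if $a_{u,v}=k$. For $u<v$ set $\beta^+(v,u)=-\beta^-(u,v)$ and $\beta^-(v,u)=-\beta^+(u,v)$. A pair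 $\{u,v\}$ is an edge if $a_{u,v}>0$ and a null-edge if $a_{u,v}=0$. A $(u,v)$-walk is a sequence $W=\langle w_0,\dots,w_p\rangle$ of elements of $[n]$ with $w_0=u$, $w_p=v$. It is an upper-bound-walk if for each $i$, $\{w_{i-1},w_i\}$ is an edge whenever $w_{i-1}<w_i$ (null-edges only traversed from larger to smaller vertex); it is a lower-bound-walk if for each $i$, $\{w_{i-1},w_i\}$ is an edge whenever $w_{i-1}>w_i$. For an upper-bound-walk, $\beta^+(W)=\sum_{i=1}^p\beta^+(w_{i-1},w_i)$; for a lower-bound-walk, $\beta^-(W)=\sum_{i=1}^p\beta^-(w_{i-1},w_i)$. A path is a walk with no repeated vertices. *)

theory Defs
  imports "HOL-Analysis.Analysis"
begin

text \<open>
  Square matrices of order \<open>n\<close> are functions on pairs of naturals, read only on the index set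
  \<open>{1..n}\<close>. Vectors with \<open>k\<close> components (real or integer) are functions on the naturals, read
  only on \<open>{1..k}\<close>.
\<close>

definition robinson_matrix :: "nat \<Rightarrow> (nat \<Rightarrow> nat \<Rightarrow> 'a::linorder) \<Rightarrow> bool" where
  "robinson_matrix n a \<longleftrightarrow>
     (\<forall>u\<in>{1..n}. \<forall>v\<in>{1..n}. a u v = a v u) \<and>
     (\<forall>u\<in>{1..n}. \<forall>v\<in>{1..n}. \<forall>w\<in>{1..n}.
        u < v \<and> v < w \<longrightarrow> a u v \<ge> a u w \<and> a v w \<ge> a u w)"

definition DD :: "nat \<Rightarrow> (nat \<Rightarrow> real) set" where
  "DD k = {d. (\<forall>i\<in>{1..<k}. d i > d (Suc i)) \<and> (1 \<le> k \<longrightarrow> d k > 0)}"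

definition ext_threshold :: "nat \<Rightarrow> (nat \<Rightarrow> real) \<Rightarrow> nat \<Rightarrow> ereal" where
  "ext_threshold k d t = (if t = 0 then \<infinity> else if t = k + 1 then -\<infinity> else ereal (d t))"

definition uniform_embedding ::
  "nat \<Rightarrow> nat \<Rightarrow> (nat \<Rightarrow> nat \<Rightarrow> nat) \<Rightarrow> (nat \<Rightarrow> real) \<Rightarrow> (nat \<Rightarrow> real) \<Rightarrow> bool" where
  "uniform_embedding n k a d f \<longleftrightarrow>
     (\<forall>u\<in>{1..n}. \<forall>v\<in>{1..n}. \<forall>t\<in>{0..k}.
        a u v = t \<longleftrightarrow>
          ext_threshold k d (t + 1) < ereal \<bar>f v - f u\<bar> \<and>
          ereal \<bar>f v - f u\<bar> \<le> ext_threshold k d t)"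

definition has_uniform_embedding :: "nat \<Rightarrow> nat \<Rightarrow> (nat \<Rightarrow> nat \<Rightarrow> nat) \<Rightarrow> bool" where
  "has_uniform_embedding n k a \<longleftrightarrow> (\<exists>d\<in>DD k. \<exists>f. uniform_embedding n k a d f)"

definition chi :: "nat \<Rightarrow> nat \<Rightarrow> int" where
  "chi i = (\<lambda>j. if j = i then 1 else 0)"

text \<open>
  The bounds of a pair are first given for \<open>u < v\<close>, and then extended to decreasing pairs.
  The upper bound of an increasing null-edge and the lower bound of a decreasing null-edge are
  undefined in the mathematics; they get the dummy value zero here, and the walks below never
  take such steps. The values at \<open>u = v\<close> are likewise meaningless; paths have no such step.
\<close>

definition beta_plus_incr :: "(nat \<Rightarrow> nat \<Rightarrow> nat) \<Rightarrow> nat \<Rightarrow> nat \<Rightarrow> nat \<Rightarrow> int" where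
  "beta_plus_incr a u v = (if a u v \<ge> 1 then chi (a u v) else (\<lambda>j. 0))"

definition beta_minus_incr :: "nat \<Rightarrow> (nat \<Rightarrow> nat \<Rightarrow> nat) \<Rightarrow> nat \<Rightarrow> nat \<Rightarrow> nat \<Rightarrow> int" where
  "beta_minus_incr k a u v = (if a u v = k then (\<lambda>j. 0) else chi (a u v + 1))"

definition beta_plus :: "nat \<Rightarrow> (nat \<Rightarrow> nat \<Rightarrow> nat) \<Rightarrow> nat \<Rightarrow> nat \<Rightarrow> nat \<Rightarrow> int" where
  "beta_plus k a u v =
     (if u < v then beta_plus_incr a u v else (\<lambda>j. - beta_minus_incr k a v u j))"

definition beta_minus :: "nat \<Rightarrow> (nat \<Rightarrow> nat \<Rightarrow> nat) \<Rightarrow> nat \<Rightarrow> nat \<Rightarrow> nat \<Rightarrow> int" where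
  "beta_minus k a u v =
     (if u < v then beta_minus_incr k a u v else (\<lambda>j. - beta_plus_incr a v u j))"

definition is_edge :: "(nat \<Rightarrow> nat \<Rightarrow> nat) \<Rightarrow> nat \<Rightarrow> nat \<Rightarrow> bool" where
  "is_edge a u v \<longleftrightarrow> a u v > 0"

definition is_walk :: "nat \<Rightarrow> nat \<Rightarrow> nat \<Rightarrow> nat list \<Rightarrow> bool" where
  "is_walk n u v W \<longleftrightarrow> W \<noteq> [] \<and> set W \<subseteq> {1..n} \<and> hd W = u \<and> last W = v"

definition upper_bound_walk ::
  "nat \<Rightarrow> (nat \<Rightarrow> nat \<Rightarrow> nat) \<Rightarrow> nat \<Rightarrow> nat \<Rightarrow> nat list \<Rightarrow> bool" where
  "upper_bound_walk n a u v W \<longleftrightarrow> is_walk n u v W \<and>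
     (\<forall>i\<in>{1..<length W}. W ! (i - 1) < W ! i \<longrightarrow> is_edge a (W ! (i - 1)) (W ! i))"

definition lower_bound_walk ::
  "nat \<Rightarrow> (nat \<Rightarrow> nat \<Rightarrow> nat) \<Rightarrow> nat \<Rightarrow> nat \<Rightarrow> nat list \<Rightarrow> bool" where
  "lower_bound_walk n a u v W \<longleftrightarrow> is_walk n u v W \<and>
     (\<forall>i\<in>{1..<length W}. W ! (i - 1) > W ! i \<longrightarrow> is_edge a (W ! (i - 1)) (W ! i))"

definition upper_bound_path ::
  "nat \<Rightarrow> (nat \<Rightarrow> nat \<Rightarrow> nat) \<Rightarrow> nat \<Rightarrow> nat \<Rightarrow> nat list \<Rightarrow> bool" where
  "upper_bound_path n a u v W \<longleftrightarrow> upper_bound_walk n a u v W \<and> distinct W"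

definition lower_bound_path ::
  "nat \<Rightarrow> (nat \<Rightarrow> nat \<Rightarrow> nat) \<Rightarrow> nat \<Rightarrow> nat \<Rightarrow> nat list \<Rightarrow> bool" where
  "lower_bound_path n a u v W \<longleftrightarrow> lower_bound_walk n a u v W \<and> distinct W"

definition beta_plus_walk :: "nat \<Rightarrow> (nat \<Rightarrow> nat \<Rightarrow> nat) \<Rightarrow> nat list \<Rightarrow> nat \<Rightarrow> int" where
  "beta_plus_walk k a W = (\<lambda>j. \<Sum>i\<in>{1..<length W}. beta_plus k a (W ! (i - 1)) (W ! i) j)"

definition beta_minus_walk :: "nat \<Rightarrow> (nat \<Rightarrow> nat \<Rightarrow> nat) \<Rightarrow> nat list \<Rightarrow> nat \<Rightarrow> int" where
  "beta_minus_walk k a W = (\<lambda>j. \<Sum>i\<in>{1..<length W}. beta_minus k a (W ! (i - 1)) (W ! i) j)"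

definition dot :: "nat \<Rightarrow> (nat \<Rightarrow> int) \<Rightarrow> (nat \<Rightarrow> real) \<Rightarrow> real" where
  "dot k b d = (\<Sum>j\<in>{1..k}. of_int (b j) * d j)"

end

theory Submission
  imports Defs
begin

text \<open>
  A uniform embedding \<open>f\<close> need not be increasing, and may even identify vertices. After a
  perturbation of \<open>f\<close> and of the thresholds it is injective. Say that \<open>(l, r)\<close> is an inversion if
  \<open>f l < f r\<close> and \<open>r < l\<close>. The vertices embedded between the endpoints of a widest inversion are not
  distinguished by any vertex outside, so they can be rearranged among themselves; an induction
  on the number of vertices turns \<open>f\<close> into a strictly increasing embedding. For such an embedding,
  \<open>f v - f u\<close> lies between the bounds given by any lower and upper bound path.

  Conversely, the upper and lower bounds on the differences \<open>p v - p u\<close> of an increasing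
  embedding form a system of strict difference constraints. It is solvable if all simple cycles
  of the constraint graph have positive weight, and cutting a cycle at two of its vertices shows
  that this is the path inequality.
\<close>

section \<open>Thresholds and distance classes\<close>

lemma DD_antimono:
  assumes "d \<in> DD k" "1 \<le> i" "i \<le> j" "j \<le> k"
  shows "d j \<le> d i"
  using assms(3,2,4)
proof (induction j rule: dec_induct)
  case base
  then show ?case by simp
next
  case (step j)
  then have "d (Suc j) < d j"
    using assms(1) by (auto simp: DD_def)
  with step show ?case by auto
qed

lemma DD_pos:
  assumes "d \<in> DD k" "1 \<le> i" "i \<le> k"
  shows "0 < d i"
proof -
  have "0 < d k" using assms by (auto simp: DD_def)
  also have "d k \<le> d i" using assms by (intro DD_antimono) auto
  finally show ?thesis .
qed

text \<open>The distance class without extended reals: the guards drop the bound where the threshold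
  is infinite, below at \<open>t = k\<close> and above at \<open>t = 0\<close>.\<close>

definition in_class :: "nat \<Rightarrow> (nat \<Rightarrow> real) \<Rightarrow> nat \<Rightarrow> real \<Rightarrow> bool" where
  "in_class k d t z \<longleftrightarrow> (t < k \<longrightarrow> d (t + 1) < z) \<and> (0 < t \<longrightarrow> z \<le> d t)"

text \<open>For \<open>d\<close> in \<open>DD k\<close> and entries at most \<open>k\<close> the
  classes are disjoint, so membership encodes the equivalence of the original notion. The free set
  \<open>V\<close> lets an embedding be restricted to the span of an inversion.\<close>

definition embeds_on ::
  "nat \<Rightarrow> (nat \<Rightarrow> real) \<Rightarrow> ('a \<Rightarrow> 'a \<Rightarrow> nat) \<Rightarrow> 'a set \<Rightarrow> ('a \<Rightarrow> real) \<Rightarrow> bool" where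
  "embeds_on k d a V f \<longleftrightarrow> (\<forall>u\<in>V. \<forall>v\<in>V. in_class k d (a u v) \<bar>f v - f u\<bar>)"

text \<open>If \<open>t < t'\<close>, then \<open>z \<le> d t' \<le> d (t + 1) < y\<close>. Used in
  both directions with \<open>y = z\<close>, this makes the class of a distance unique.\<close>

lemma in_class_antimono:
  assumes "d \<in> DD k" "in_class k d t y" "in_class k d t' z" "y \<le> z" "t' \<le> k"
  shows "t' \<le> t"
proof (rule ccontr)
  assume "\<not> t' \<le> t"
  then have "d t' \<le> d (t + 1)"
    using assms by (intro DD_antimono) auto
  then show False
    using assms \<open>\<not> t' \<le> t\<close> by (auto simp: in_class_def)
qed

lemma in_class_convex:
  assumes "in_class k d t x" "in_class k d t z" "x \<le> y" "y \<le> z"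
  shows "in_class k d t y"
  using assms by (auto simp: in_class_def)

lemma ext_threshold_iff_in_class:
  assumes "t \<le> k"
  shows "ext_threshold k d (t + 1) < ereal z \<and> ereal z \<le> ext_threshold k d t \<longleftrightarrow> in_class k d t z"
  using assms by (auto simp: ext_threshold_def in_class_def)

lemma uniform_embedding_iff:
  assumes "d \<in> DD k" "\<forall>u\<in>{1..n}. \<forall>v\<in>{1..n}. a u v \<in> {0..k}"
  shows "uniform_embedding n k a d f \<longleftrightarrow> embeds_on k d a {1..n} f"
proof
  assume "uniform_embedding n k a d f"
  then show "embeds_on k d a {1..n} f"
    using assms(2) unfolding uniform_embedding_def embeds_on_def
    by (metis atLeastAtMost_iff ext_threshold_iff_in_class)
next
  assume emb: "embeds_on k d a {1..n} f"
  have "a u v = t \<longleftrightarrow> in_class k d t \<bar>f v - f u\<bar>"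
    if "u \<in> {1..n}" "v \<in> {1..n}" "t \<le> k" for u v t
  proof -
    have "in_class k d (a u v) \<bar>f v - f u\<bar>" "a u v \<le> k"
      using emb assms(2) that by (auto simp: embeds_on_def)
    then show ?thesis
      using in_class_antimono[OF assms(1)] that(3) by (metis antisym order_refl)
  qed
  then show "uniform_embedding n k a d f"
    unfolding uniform_embedding_def using ext_threshold_iff_in_class by simp
qed

section \<open>Increasing embeddings\<close>

text \<open>
  Raising all thresholds by \<open>\<epsilon>\<close> gives slack in the non-strict inequalities, so that a perturbation
  of the points by at most \<open>\<epsilon>\<close> can remove all coincidences.
\<close>
lemma injective_embedding:
  fixes n :: nat and f :: "nat \<Rightarrow> real"
  assumes d: "d \<in> DD k" and emb: "embeds_on k d a {1..n} f"
  obtains d' f' where "d' \<in> DD k" "embeds_on k d' a {1..n} f'" "inj_on f' {1..n}"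
proof -
  \<comment> \<open>Distinct vertices get distinct shifts, all between \<open>0\<close> and
    \<open>e\<close>, so no distance grows by more than \<open>e\<close>.\<close>
  define g where "g = (\<lambda>e v. f v + e * (real v / real n))"
  define h where "h = (\<lambda>(e::real) i. d i + e)"
  have lim: "((\<lambda>e. g e u) \<longlongrightarrow> f u) (at_right 0)" for u
  proof -
    have "((\<lambda>e. f u + e * (real u / real n)) \<longlongrightarrow> f u + 0 * (real u / real n)) (at_right 0)"
      by (intro tendsto_intros)
    then show ?thesis by (simp add: g_def)
  qed
  have limh: "((\<lambda>e. h e i) \<longlongrightarrow> d i) (at_right 0)" for i
    unfolding h_def by (auto intro!: tendsto_eq_intros)
  have pos: "\<forall>\<^sub>F e::real in at_right 0. 0 < e"
    by (simp add: eventually_at_right_less)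
  have "\<forall>\<^sub>F e in at_right 0. \<forall>u\<in>{1..n}. \<forall>v\<in>{1..n}.
      (u \<noteq> v \<longrightarrow> g e u \<noteq> g e v) \<and> in_class k (h e) (a u v) \<bar>g e v - g e u\<bar>"
  proof (intro eventually_ball_finite ballI eventually_conj finite_atLeastAtMost)
    fix u v assume uv: "u \<in> {1..n}" "v \<in> {1..n}"
    show "\<forall>\<^sub>F e in at_right 0. u \<noteq> v \<longrightarrow> g e u \<noteq> g e v"
    proof (cases "f u = f v")
      case True
      from pos show ?thesis
        by eventually_elim (use True uv in \<open>auto simp: g_def\<close>)
    next
      case False
      have "((\<lambda>e. g e u - g e v) \<longlongrightarrow> f u - f v) (at_right 0)"
        by (intro tendsto_diff lim)
      then have "\<forall>\<^sub>F e in at_right 0. g e u - g e v \<noteq> 0"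
        using False by (intro tendsto_imp_eventually_ne) auto
      then show ?thesis by eventually_elim auto
    qed
    have cl: "in_class k d (a u v) \<bar>f v - f u\<bar>"
      using emb uv by (auto simp: embeds_on_def)
    \<comment> \<open>The strict lower bounds are open conditions and survive a small
      \<open>e\<close>. The upper bounds may be attained; the raised thresholds absorb the growth of
      the distance.\<close>
    have "\<forall>\<^sub>F e in at_right 0. a u v < k \<longrightarrow> h e (a u v + 1) < \<bar>g e v - g e u\<bar>"
    proof (cases "a u v < k")
      case True
      have "((\<lambda>e. \<bar>g e v - g e u\<bar> - h e (a u v + 1)) \<longlongrightarrow> \<bar>f v - f u\<bar> - d (a u v + 1))
          (at_right 0)"
        by (intro tendsto_intros lim limh)
      then have "\<forall>\<^sub>F e in at_right 0. 0 < \<bar>g e v - g e u\<bar> - h e (a u v + 1)"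
        using True cl by (intro order_tendstoD(1)) (auto simp: in_class_def)
      then show ?thesis by eventually_elim auto
    qed auto
    moreover have "\<forall>\<^sub>F e in at_right 0. 0 < a u v \<longrightarrow> \<bar>g e v - g e u\<bar> \<le> h e (a u v)"
      using pos
    proof eventually_elim
      case (elim e)
      have "0 < real n" "\<bar>real v - real u\<bar> \<le> real n" using uv by auto
      then have "\<bar>real v / real n - real u / real n\<bar> \<le> 1"
        by (simp flip: diff_divide_distrib)
      then have "\<bar>e * (real v / real n - real u / real n)\<bar> \<le> e"
        using elim by (simp add: abs_mult)
      moreover have "\<bar>g e v - g e u\<bar> \<le>
          \<bar>f v - f u\<bar> + \<bar>e * (real v / real n - real u / real n)\<bar>"
        unfolding g_def by (simp add: algebra_simps)
      ultimately show ?case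
        using cl by (auto simp: in_class_def h_def)
    qed
    ultimately show "\<forall>\<^sub>F e in at_right 0. in_class k (h e) (a u v) \<bar>g e v - g e u\<bar>"
      by eventually_elim (auto simp: in_class_def)
  qed
  then have "\<forall>\<^sub>F e in at_right 0. 0 < e \<and> (\<forall>u\<in>{1..n}. \<forall>v\<in>{1..n}.
      (u \<noteq> v \<longrightarrow> g e u \<noteq> g e v) \<and> in_class k (h e) (a u v) \<bar>g e v - g e u\<bar>)"
    using pos by (rule eventually_conj[rotated])
  then obtain e :: real where e: "0 < e"
      "\<forall>u\<in>{1..n}. \<forall>v\<in>{1..n}. (u \<noteq> v \<longrightarrow> g e u \<noteq> g e v)
        \<and> in_class k (h e) (a u v) \<bar>g e v - g e u\<bar>"
    using eventually_happens'[OF trivial_limit_at_right_real] by blast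
  have "h e \<in> DD k"
    using d e(1) by (auto simp: DD_def h_def)
  moreover have "embeds_on k (h e) a {1..n} (g e)" "inj_on (g e) {1..n}"
    using e(2) by (auto simp: embeds_on_def inj_on_def)
  ultimately show ?thesis by (rule that)
qed

section \<open>Inversions and sorting\<close>

text \<open>Plays the part of the Robinson property for the order given by \<open>f\<close>;
  \<open>y\<close> and \<open>z\<close> may lie on either side of \<open>x\<close>.\<close>

lemma embedding_antimono:
  assumes "d \<in> DD k" "embeds_on k d a V f" "x \<in> V" "y \<in> V" "z \<in> V"
    "a x z \<le> k" "\<bar>f y - f x\<bar> \<le> \<bar>f z - f x\<bar>"
  shows "a x z \<le> a x y"
  using assms by (intro in_class_antimono[of d k "a x y" "\<bar>f y - f x\<bar>" "a x z" "\<bar>f z - f x\<bar>"])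
    (auto simp: embeds_on_def)

definition inversions :: "nat set \<Rightarrow> (nat \<Rightarrow> real) \<Rightarrow> (nat \<times> nat) set" where
  "inversions V f = {(p, q). p \<in> V \<and> q \<in> V \<and> f p < f q \<and> q < p}"

text \<open>
  If \<open>x\<close> distinguishes the endpoints of an inversion, then the Robinson property in both orders
  forces \<open>x\<close> to form an inversion with the farther endpoint; this is impossible for a
  widest inversion.
\<close>
lemma widest_inversion:
  fixes f :: "nat \<Rightarrow> real"
  assumes rob: "robinson_matrix n a" and V: "V \<subseteq> {1..n}"
    and le: "\<forall>u\<in>V. \<forall>v\<in>V. a u v \<le> k"
    and d: "d \<in> DD k" and emb: "embeds_on k d a V f" and ne: "inversions V f \<noteq> {}"
  obtains l r where "l \<in> V" "r \<in> V" "f l < f r" "r < l"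
    "\<And>x. x \<in> V \<Longrightarrow> f x < f l \<or> f r < f x \<Longrightarrow> a x l = a x r"
proof -
  have fin: "finite V" using V finite_subset by blast
  have R: "a u w \<le> a u v \<and> a u w \<le> a v w" if "u \<in> V" "v \<in> V" "w \<in> V" "u < v" "v < w" for u v w
    using rob V that unfolding robinson_matrix_def by blast
  have sym: "a u v = a v u" if "u \<in> V" "v \<in> V" for u v
    using rob V that unfolding robinson_matrix_def by blast
  have "finite (inversions V f)"
    by (rule finite_subset[of _ "V \<times> V"]) (use fin in \<open>auto simp: inversions_def\<close>)
  then have "Max ((\<lambda>(p, q). f q - f p) ` inversions V f) \<in> (\<lambda>(p, q). f q - f p) ` inversions V f"
    using ne by (intro Max_in) auto
  then obtain l r where lr: "(l, r) \<in> inversions V f"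
    and eq: "Max ((\<lambda>(p, q). f q - f p) ` inversions V f) = f r - f l" by auto
  have max: "f q - f p \<le> f r - f l" if "(p, q) \<in> inversions V f" for p q
    unfolding eq[symmetric] using \<open>finite (inversions V f)\<close> that by (intro Max_ge) force+
  from lr have lr': "l \<in> V" "r \<in> V" "f l < f r" "r < l"
    by (auto simp: inversions_def)
  have "a x l = a x r" if x: "x \<in> V" and "f x < f l \<or> f r < f x" for x
    using that(2)
  proof
    assume lt: "f x < f l"
    then have "(x, r) \<notin> inversions V f"
      using max[of x r] by auto
    \<comment> \<open>\<open>x\<close> is embedded to the left of \<open>r\<close>, so the absence
      of an inversion fixes their order as vertices, and the Robinson property applies to
      \<open>x < r < l\<close>.\<close>
    then have "x < r"
      using lt lr' x by (cases x r rule: linorder_cases) (auto simp: inversions_def)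
    then have "a x l \<le> a x r"
      using R[of x r l] lr' x by auto
    moreover have "a x r \<le> a x l"
      using embedding_antimono[OF d emb x lr'(1,2)] le x lr' lt by auto
    ultimately show ?thesis by simp
  next
    assume lt: "f r < f x"
    then have "(l, x) \<notin> inversions V f"
      using max[of l x] by auto
    then have "l < x"
      using lt lr' x by (cases l x rule: linorder_cases) (auto simp: inversions_def)
    then have "a x r \<le> a x l"
      using R[of r l x] lr' x sym[of x] by auto
    moreover have "a x l \<le> a x r"
      using embedding_antimono[OF d emb x lr'(2,1)] le x lr' lt by auto
    ultimately show ?thesis by simp
  qed
  then show ?thesis using that lr' by blast
qed

text \<open>For \<open>u\<close> outside \<open>S\<close>, the entries with \<open>l\<close> and
  \<open>r\<close> agree, and monotonicity squeezes the entry with any vertex of \<open>S\<close> to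
  the same value. Any new position between \<open>f l\<close> and \<open>f r\<close> then stays in
  that class, because classes are convex.\<close>

lemma embeds_on_splice:
  fixes f g :: "nat \<Rightarrow> real"
  assumes sym: "\<forall>u\<in>V. \<forall>v\<in>V. a u v = a v u" and le: "\<forall>u\<in>V. \<forall>v\<in>V. a u v \<le> k"
    and d: "d \<in> DD k" and emb: "embeds_on k d a V f"
    and lr: "l \<in> V" "r \<in> V"
    and S: "S = {x\<in>V. f l \<le> f x \<and> f x \<le> f r}"
    and twin: "\<And>x. x \<in> V \<Longrightarrow> f x < f l \<or> f r < f x \<Longrightarrow> a x l = a x r"
    and embg: "embeds_on k d a S g" and g: "\<forall>x\<in>S. f l \<le> g x \<and> g x \<le> f r"
  shows "embeds_on k d a V (\<lambda>x. if x \<in> S then g x else f x)"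
proof -
  have out: "in_class k d (a u v) \<bar>g v - f u\<bar>" if u: "u \<in> V" "u \<notin> S" and v: "v \<in> S" for u v
  proof -
    have "v \<in> V" and fv: "f l \<le> f v" "f v \<le> f r" and gv: "f l \<le> g v" "g v \<le> f r"
      using v g S by auto
    have side: "f u < f l \<or> f r < f u" using u S by auto
    then have eq: "a u l = a u r" using twin u by auto
    have "a u v = a u l"
    proof (rule antisym)
      show "a u v \<le> a u l"
        using side
      proof
        assume "f u < f l"
        then show ?thesis
          using embedding_antimono[OF d emb u(1) lr(1) \<open>v \<in> V\<close>] le u \<open>v \<in> V\<close> fv by auto
      next
        assume "f r < f u"
        then show ?thesis
          using embedding_antimono[OF d emb u(1) lr(2) \<open>v \<in> V\<close>] le u \<open>v \<in> V\<close> fv eq by auto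
      qed
      show "a u l \<le> a u v"
        using side
      proof
        assume "f u < f l"
        then show ?thesis
          using embedding_antimono[OF d emb u(1) \<open>v \<in> V\<close> lr(2)] le u lr fv eq by auto
      next
        assume "f r < f u"
        then show ?thesis
          using embedding_antimono[OF d emb u(1) \<open>v \<in> V\<close> lr(1)] le u lr fv by auto
      qed
    qed
    moreover have "in_class k d (a u l) \<bar>f l - f u\<bar>" "in_class k d (a u l) \<bar>f r - f u\<bar>"
      using emb u lr eq unfolding embeds_on_def by metis+
    ultimately show ?thesis
      using side gv in_class_convex[of k d "a u l" "\<bar>f l - f u\<bar>" "\<bar>f r - f u\<bar>" "\<bar>g v - f u\<bar>"]
        in_class_convex[of k d "a u l" "\<bar>f r - f u\<bar>" "\<bar>f l - f u\<bar>" "\<bar>g v - f u\<bar>"]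
      by auto
  qed
  have out': "in_class k d (a u v) \<bar>f v - g u\<bar>" if "v \<in> V" "v \<notin> S" "u \<in> S" for u v
  proof -
    have "a u v = a v u" using that sym S by auto
    then show ?thesis using out[OF that] by (simp add: abs_minus_commute)
  qed
  show ?thesis
    using emb embg out out' by (auto simp: embeds_on_def)
qed

text \<open>
  The hypothesis \<open>ends\<close>, which can be arranged by a reflection, makes the interval spanned by a
  widest inversion a proper subset. It survives sorting that interval, and sorting decreases the
  number of inversions.
\<close>
lemma sort_embedding_step:
  fixes f :: "nat \<Rightarrow> real"
  assumes rob: "robinson_matrix n a" and V: "V \<subseteq> {1..n}"
    and le: "\<forall>u\<in>V. \<forall>v\<in>V. a u v \<le> k"
    and d: "d \<in> DD k"
    and IH: "\<And>W f lo hi. W \<subset> V \<Longrightarrow> embeds_on k d a W f \<Longrightarrow> inj_on f W \<Longrightarrow>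
      \<forall>x\<in>W. lo \<le> f x \<and> f x \<le> hi \<Longrightarrow>
      \<exists>g. embeds_on k d a W g \<and> strict_mono_on W g \<and> (\<forall>x\<in>W. lo \<le> g x \<and> g x \<le> hi)"
    and emb: "embeds_on k d a V f" and inj: "inj_on f V"
    and bd: "\<forall>x\<in>V. lo \<le> f x \<and> f x \<le> hi"
    and ends: "\<And>m M. m \<in> V \<Longrightarrow> M \<in> V \<Longrightarrow> \<forall>x\<in>V. f m \<le> f x \<and> f x \<le> f M \<Longrightarrow> m \<le> M"
  shows "\<exists>g. embeds_on k d a V g \<and> strict_mono_on V g \<and> (\<forall>x\<in>V. lo \<le> g x \<and> g x \<le> hi)"
  \<comment> \<open>The inner induction keeps \<open>V\<close> and lowers the number of inversions;
    \<open>IH\<close> serves the smaller vertex sets.\<close>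
  using emb inj bd ends
proof (induction "card (inversions V f)" arbitrary: f rule: less_induct)
  case (less f)
  note emb = less.prems(1) and inj = less.prems(2) and bd = less.prems(3) and ends = less.prems(4)
  show ?case
  proof (cases "inversions V f = {}")
    case True
    have "f u < f v" if "u \<in> V" "v \<in> V" "u < v" for u v
    proof -
      have "\<not> f v < f u" using True that by (auto simp: inversions_def)
      moreover have "f u \<noteq> f v" using inj that by (auto simp: inj_on_def)
      ultimately show ?thesis by simp
    qed
    then have "strict_mono_on V f" by (simp add: strict_mono_on_def)
    then show ?thesis using emb bd by blast
  next
    case False
    obtain l r where lr: "l \<in> V" "r \<in> V" "f l < f r" "r < l"
      and twin: "\<And>x. x \<in> V \<Longrightarrow> f x < f l \<or> f r < f x \<Longrightarrow> a x l = a x r"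
      using widest_inversion[OF rob V le d emb False] by blast
    define S where "S = {x\<in>V. f l \<le> f x \<and> f x \<le> f r}"
    have lrS: "l \<in> S" "r \<in> S" using lr by (auto simp: S_def)
    \<comment> \<open>Otherwise \<open>l\<close> and \<open>r\<close> would be the extreme points of
      \<open>V\<close>, and \<open>ends\<close> would give \<open>l \<le> r\<close>.\<close>
    have "S \<noteq> V"
      using ends[of l r] lr by (auto simp: S_def)
    then have "S \<subset> V" by (auto simp: S_def)
    obtain z where z: "z \<in> V" "z \<notin> S" using \<open>S \<subset> V\<close> by blast
    have "embeds_on k d a S f" "inj_on f S"
      using emb inj \<open>S \<subset> V\<close> unfolding embeds_on_def inj_on_def by blast+
    moreover have "\<forall>x\<in>S. f l \<le> f x \<and> f x \<le> f r" by (simp add: S_def)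
    ultimately obtain g where g: "embeds_on k d a S g" "strict_mono_on S g"
      and gbd: "\<forall>x\<in>S. f l \<le> g x \<and> g x \<le> f r"
      using IH[OF \<open>S \<subset> V\<close>] by blast
    define f' where "f' = (\<lambda>x. if x \<in> S then g x else f x)"
    have mono: "g u < g v" if "u \<in> S" "v \<in> S" "u < v" for u v
      using g(2) that by (auto simp: strict_mono_on_def)
    have outS: "f x < f l \<or> f r < f x" if "x \<in> V" "x \<notin> S" for x
      using that by (auto simp: S_def)
    \<comment> \<open>Sorting moves vertices of \<open>S\<close> only within the interval from
      \<open>f l\<close> to \<open>f r\<close>, which no other vertex enters.\<close>
    have order: "f' x < f' y \<longleftrightarrow> f x < f y" if "x \<in> V" "y \<in> V" "x \<notin> S \<or> y \<notin> S" for x y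
    proof -
      have in_S: "f l \<le> g y" "g y \<le> f r" "f l \<le> f y" "f y \<le> f r" if "y \<in> S" for y
        using that gbd by (auto simp: S_def)
      show ?thesis
        using that outS[of x] outS[of y] in_S[of x] in_S[of y]
        by (cases "x \<in> S"; cases "y \<in> S") (auto simp: f'_def)
    qed
    have sym: "\<forall>u\<in>V. \<forall>v\<in>V. a u v = a v u"
      using rob V unfolding robinson_matrix_def by blast
    have emb': "embeds_on k d a V f'"
      unfolding f'_def
      using embeds_on_splice[OF sym le d emb lr(1,2) S_def twin g(1) gbd] by blast
    have bd': "\<forall>x\<in>V. lo \<le> f' x \<and> f' x \<le> hi"
    proof
      fix x assume "x \<in> V"
      then show "lo \<le> f' x \<and> f' x \<le> hi"
        using bd gbd lr by (cases "x \<in> S") (force simp: f'_def)+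
    qed
    have inj': "inj_on f' V"
    proof (rule inj_onI)
      fix x y assume xy: "x \<in> V" "y \<in> V" "f' x = f' y"
      show "x = y"
      proof (cases "x \<in> S \<and> y \<in> S")
        case True
        then show ?thesis
          using mono[of x y] mono[of y x] xy(3) by (auto simp: f'_def dest: linorder_neqE_nat)
      next
        case False
        then have "f x = f y"
          using order[of x y] order[of y x] xy by force
        then show ?thesis using inj xy by (auto simp: inj_on_def)
      qed
    qed
    have ends': "m \<le> M" if m: "m \<in> V" "M \<in> V" and ext: "\<forall>x\<in>V. f' m \<le> f' x \<and> f' x \<le> f' M"
      for m M
    proof -
      \<comment> \<open>If both extremes were in \<open>S\<close>, every new position would lie
        between \<open>f l\<close> and \<open>f r\<close>, including that of \<open>z\<close>, which
        has not moved.\<close>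
      have nS: "m \<notin> S \<or> M \<notin> S"
      proof (rule ccontr)
        assume "\<not> ?thesis"
        then have "f l \<le> f' m" "f' M \<le> f r" using gbd by (auto simp: f'_def)
        then have "f l \<le> f z" "f z \<le> f r"
          using ext z by (force simp: f'_def)+
        then show False using z by (auto simp: S_def)
      qed
      \<comment> \<open>Extreme vertices of the old embedding. If the new leftmost vertex is in
        \<open>S\<close>, the old one was \<open>l\<close>; monotonicity of \<open>g\<close> makes
        the new one the smallest vertex of \<open>S\<close>, so \<open>m \<le> m0\<close>. The right
        end is symmetric.\<close>
      define m0 where "m0 = (if m \<in> S then l else m)"
      define M0 where "M0 = (if M \<in> S then r else M)"
      have "m \<le> m0"
        using ext lr mono[of l m] lrS by (force simp: m0_def f'_def)
      have "M0 \<le> M"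
        using ext lr mono[of M r] lrS by (force simp: M0_def f'_def)
      have "f m0 \<le> f x" if "x \<in> V" for x
      proof (cases "m \<in> S")
        case True
        show ?thesis
        proof (cases "x \<in> S")
          case False
          then have "f m \<le> f x"
            using order[of x m] that m ext by force
          moreover have "f l \<le> f m" using True by (simp add: S_def)
          ultimately show ?thesis using True by (simp add: m0_def)
        qed (use True in \<open>simp add: m0_def S_def\<close>)
      next
        case False
        then show ?thesis
          using order[of x m] that m ext by (force simp: m0_def)
      qed
      moreover have "f x \<le> f M0" if "x \<in> V" for x
      proof (cases "M \<in> S")
        case True
        show ?thesis
        proof (cases "x \<in> S")
          case False
          then have "f x \<le> f M"
            using order[of M x] that m ext by force
          moreover have "f M \<le> f r" using True by (simp add: S_def)
          ultimately show ?thesis using True by (simp add: M0_def)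
        qed (use True in \<open>simp add: M0_def S_def\<close>)
      next
        case False
        then show ?thesis
          using order[of M x] that m ext by (force simp: M0_def)
      qed
      moreover have "m0 \<in> V" "M0 \<in> V" using m lr by (auto simp: m0_def M0_def)
      ultimately have "m0 \<le> M0" by (intro ends) auto
      then show ?thesis using \<open>m \<le> m0\<close> \<open>M0 \<le> M\<close> by simp
    qed
    \<comment> \<open>No inversion remains inside \<open>S\<close>, those meeting the outside are
      unchanged, and \<open>(l, r)\<close> disappears.\<close>
    have "inversions V f' \<subset> inversions V f"
    proof
      show "inversions V f' \<subseteq> inversions V f"
      proof (rule subrelI)
        fix p q assume pq: "(p, q) \<in> inversions V f'"
        then have "p \<notin> S \<or> q \<notin> S"
          using mono[of q p] by (auto simp: inversions_def f'_def)
        then show "(p, q) \<in> inversions V f"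
          using pq order[of p q] by (auto simp: inversions_def)
      qed
      have "(l, r) \<in> inversions V f" using lr by (auto simp: inversions_def)
      moreover have "(l, r) \<notin> inversions V f'"
        using mono[of r l] lr lrS by (auto simp: inversions_def f'_def)
      ultimately show "inversions V f' \<noteq> inversions V f" by blast
    qed
    moreover have "finite (inversions V f)"
      by (rule finite_subset[of _ "V \<times> V"])
        (use V finite_subset[OF V] in \<open>auto simp: inversions_def\<close>)
    ultimately have "card (inversions V f') < card (inversions V f)"
      by (rule psubset_card_mono[rotated])
    then show ?thesis
      using less.hyps[OF _ emb' inj' bd' ends'] by blast
  qed
qed

text \<open>Induction over proper subsets. The bounds \<open>lo\<close> and \<open>hi\<close> are
  part of the claim so that a sorted part stays within the interval it occupied.\<close>

lemma sort_embedding: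
  fixes f :: "nat \<Rightarrow> real"
  assumes rob: "robinson_matrix n a" and V: "V \<subseteq> {1..n}"
    and le: "\<forall>u\<in>V. \<forall>v\<in>V. a u v \<le> k"
    and d: "d \<in> DD k"
    and emb: "embeds_on k d a V f" and inj: "inj_on f V"
    and bd: "\<forall>x\<in>V. lo \<le> f x \<and> f x \<le> hi"
  shows "\<exists>g. embeds_on k d a V g \<and> strict_mono_on V g \<and> (\<forall>x\<in>V. lo \<le> g x \<and> g x \<le> hi)"
proof -
  have "finite V" using V finite_subset by blast
  then show ?thesis
    using V le emb inj bd
  proof (induction V arbitrary: f lo hi rule: finite_psubset_induct)
    case (psubset V)
    note V = psubset.prems(1) and le = psubset.prems(2)
    have IH: "\<exists>g. embeds_on k d a W g \<and> strict_mono_on W g \<and> (\<forall>x\<in>W. lo \<le> g x \<and> g x \<le> hi)"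
      if "W \<subset> V" "embeds_on k d a W f" "inj_on f W" "\<forall>x\<in>W. lo \<le> f x \<and> f x \<le> hi"
      for W lo hi and f :: "nat \<Rightarrow> real"
    proof -
      have "W \<subseteq> {1..n}" "\<forall>u\<in>W. \<forall>v\<in>W. a u v \<le> k"
        using that(1) V le by blast+
      then show ?thesis using psubset.IH[OF that(1)] that(2-4) by blast
    qed
    note step = sort_embedding_step[OF rob V le d IH]
    show ?case
    proof (cases "\<exists>m\<in>V. \<exists>M\<in>V. (\<forall>x\<in>V. f m \<le> f x \<and> f x \<le> f M) \<and> M < m")
      case False
      then show ?thesis
        by (intro step[where f = f] psubset.prems) (auto simp: not_less)
    next
      case True
      then obtain m M where mM: "m \<in> V" "M \<in> V" "M < m"
        and ext: "\<forall>x\<in>V. f m \<le> f x \<and> f x \<le> f M" by blast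
      \<comment> \<open>This reflection preserves distances and the range from \<open>lo\<close> to
        \<open>hi\<close>, and it exchanges the two extreme vertices, so that the smaller one comes
        first.\<close>
      define f' where "f' = (\<lambda>x. lo + hi - f x)"
      have "embeds_on k d a V f'" "inj_on f' V" "\<forall>x\<in>V. lo \<le> f' x \<and> f' x \<le> hi"
        using psubset.prems by (auto simp: f'_def embeds_on_def inj_on_def abs_minus_commute)
      moreover have "p \<le> q"
        if pq: "p \<in> V" "q \<in> V" "\<forall>x\<in>V. f' p \<le> f' x \<and> f' x \<le> f' q" for p q
      proof -
        have "f p = f M" "f q = f m"
          using pq mM ext by (force simp: f'_def)+
        then have "p = M" "q = m"
          using pq mM psubset.prems(4) by (auto simp: inj_on_def)
        then show ?thesis using mM by simp
      qed
      ultimately show ?thesis by (intro step[where f = f'])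
    qed
  qed
qed

lemma increasing_embedding:
  assumes rob: "robinson_matrix n a"
    and le: "\<forall>u\<in>{1..n}. \<forall>v\<in>{1..n}. a u v \<in> {0..k}"
    and "has_uniform_embedding n k a"
  obtains d f where "d \<in> DD k" "embeds_on k d a {1..n} f" "strict_mono_on {1..n} f"
proof -
  obtain d0 f0 where "d0 \<in> DD k" "embeds_on k d0 a {1..n} f0"
    using assms uniform_embedding_iff unfolding has_uniform_embedding_def by blast
  then obtain d f where df: "d \<in> DD k" "embeds_on k d a {1..n} f" "inj_on f {1..n}"
    using injective_embedding by blast
  define lo hi where "lo = Min (f ` {1..n})" and "hi = Max (f ` {1..n})"
  have "\<forall>x\<in>{1..n}. lo \<le> f x \<and> f x \<le> hi"
    by (simp add: lo_def hi_def)
  moreover have "\<forall>u\<in>{1..n}. \<forall>v\<in>{1..n}. a u v \<le> k" using le by auto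
  ultimately show ?thesis
    using sort_embedding[OF rob order_refl _ df] df(1) that by blast
qed

section \<open>Walks and potentials\<close>

definition walk_weight :: "('a \<Rightarrow> 'a \<Rightarrow> real) \<Rightarrow> 'a list \<Rightarrow> real" where
  "walk_weight w W = (\<Sum>i\<in>{1..<length W}. w (W ! (i - 1)) (W ! i))"

lemma walk_weight_singleton [simp]: "walk_weight w [x] = 0"
  by (simp add: walk_weight_def)

lemma walk_weight_Cons_Cons [simp]:
  "walk_weight w (x # y # zs) = w x y + walk_weight w (y # zs)"
proof -
  have "walk_weight w (x # y # zs) =
      w x y + (\<Sum>i\<in>{Suc 1..<Suc (length (y # zs))}. w ((x # y # zs) ! (i - 1)) ((x # y # zs) ! i))"
    unfolding walk_weight_def by (subst sum.atLeast_Suc_lessThan) auto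
  also have "(\<Sum>i\<in>{Suc 1..<Suc (length (y # zs))}. w ((x # y # zs) ! (i - 1)) ((x # y # zs) ! i))
      = walk_weight w (y # zs)"
    unfolding walk_weight_def sum.shift_bounds_Suc_ivl
    by (rule sum.cong) (auto simp: nth_Cons split: nat.split)
  finally show ?thesis .
qed

lemma walk_weight_append:
  "walk_weight w (xs @ x # ys) = walk_weight w (xs @ [x]) + walk_weight w (x # ys)"
proof (induction xs)
  case (Cons z xs)
  then show ?case by (cases xs) auto
qed simp

lemma walk_weight_rev:
  assumes "successively (\<lambda>x y. w' y x = - w x y) W"
  shows "walk_weight w' (rev W) = - walk_weight w W"
  using assms
proof (induction W rule: induct_list012)
  case (3 x y zs)
  then show ?case
    using walk_weight_append[of w' "rev zs" y "[x]"] by simp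
qed (simp_all add: walk_weight_def)

lemma walk_weight_diff_const:
  "walk_weight (\<lambda>x y. w x y - e) W = walk_weight w W - e * real (length W - 1)"
  by (simp add: walk_weight_def sum_subtractf)

lemma walk_weight_upper:
  assumes "successively (\<lambda>x y. g y - g x \<le> w x y) W" "W \<noteq> []"
  shows "g (last W) - g (hd W) \<le> walk_weight w W"
  using assms by (induction W rule: induct_list012) auto

text \<open>Only increasing steps are strict, but a walk ending above its start contains one: if the
  first step does not increase, the rest still ends above its own start.\<close>

lemma walk_weight_lower:
  fixes W :: "'a::linorder list"
  assumes "successively (\<lambda>x y. w x y \<le> g y - g x \<and> (x < y \<longrightarrow> w x y < g y - g x)) W" "W \<noteq> []"
  shows "walk_weight w W \<le> g (last W) - g (hd W) \<and>
    (hd W < last W \<longrightarrow> walk_weight w W < g (last W) - g (hd W))"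
  using assms
proof (induction W rule: induct_list012)
  case (3 x y zs)
  then show ?case by (cases "x < y") force+
qed auto

text \<open>Distinctness rules out steps with \<open>x = y\<close>, where the bounds have no
  meaning.\<close>

lemma successively_distinct_mono:
  assumes "successively P W" "distinct W"
    and "\<And>x y. x \<in> set W \<Longrightarrow> y \<in> set W \<Longrightarrow> x \<noteq> y \<Longrightarrow> P x y \<Longrightarrow> Q x y"
  shows "successively Q W"
  using assms by (induction W rule: induct_list012) auto

text \<open>
  If all simple cycles have positive weight, a small amount can be subtracted from every arc
  while keeping them nonnegative; shortest path distances are then a potential.
\<close>
lemma strict_potential:
  fixes w :: "'a \<Rightarrow> 'a \<Rightarrow> real"
  assumes fin: "finite V"
    and cyc: "\<And>x c. c \<noteq> [] \<Longrightarrow> distinct (x # c) \<Longrightarrow> set (x # c) \<subseteq> V \<Longrightarrow>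
      successively E (x # c @ [x]) \<Longrightarrow> 0 < walk_weight w (x # c @ [x])"
  obtains p where "\<And>x y. x \<in> V \<Longrightarrow> y \<in> V \<Longrightarrow> x \<noteq> y \<Longrightarrow> E x y \<Longrightarrow> p y - p x < w x y"
proof -
  define L where "L = {W. set W \<subseteq> V \<and> distinct W}"
  have finL: "finite L"
    unfolding L_def using finite_subset_distinct[OF fin] by (simp add: conj_commute)
  \<comment> \<open>Simple cycles, stored without the repeated end vertex. There are finitely many,
    so one \<open>e\<close> serves them all.\<close>
  define C where "C = {W\<in>L. 2 \<le> length W \<and> successively E (W @ [hd W])}"
  have "\<forall>\<^sub>F e in at_right 0. \<forall>W\<in>C. 0 < walk_weight w (W @ [hd W]) - e * real (length W)"
  proof (rule eventually_ball_finite)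
    show "finite C" using finL by (simp add: C_def)
    show "\<forall>W\<in>C. \<forall>\<^sub>F e in at_right 0. 0 < walk_weight w (W @ [hd W]) - e * real (length W)"
    proof
      fix W assume W: "W \<in> C"
      then obtain x c where "W = x # c" "c \<noteq> []"
        by (cases W; cases "tl W") (auto simp: C_def)
      then have "0 < walk_weight w (W @ [hd W])"
        using W cyc[of c x] by (auto simp: C_def L_def)
      moreover have "((\<lambda>e. walk_weight w (W @ [hd W]) - e * real (length W)) \<longlongrightarrow>
          walk_weight w (W @ [hd W])) (at_right 0)"
        by (auto intro!: tendsto_eq_intros)
      ultimately show "\<forall>\<^sub>F e in at_right 0. 0 < walk_weight w (W @ [hd W]) - e * real (length W)"
        by (intro order_tendstoD(1)) auto
    qed
  qed
  moreover have "\<forall>\<^sub>F e::real in at_right 0. 0 < e"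
    by (simp add: eventually_at_right_less)
  ultimately have "\<forall>\<^sub>F e::real in at_right 0. 0 < e \<and>
      (\<forall>W\<in>C. 0 < walk_weight w (W @ [hd W]) - e * real (length W))"
    by eventually_elim blast
  then obtain e :: real where e: "0 < e"
      "\<And>W. W \<in> C \<Longrightarrow> 0 < walk_weight w (W @ [hd W]) - e * real (length W)"
    using eventually_happens'[OF trivial_limit_at_right_real] by blast
  define w' where "w' = (\<lambda>x y. w x y - e)"
  \<comment> \<open>Simple walks leaving \<open>x\<close> with any end vertex. The trivial walk is
    among them for \<open>x\<close> in \<open>V\<close>, so \<open>dist\<close> is a minimum over a
    nonempty finite set.\<close>
  define P where "P = (\<lambda>x. {W\<in>L. W \<noteq> [] \<and> hd W = x \<and> successively E W})"
  define dist where "dist = (\<lambda>x. Min (walk_weight w' ` P x))"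
  have finP: "finite (P x)" for x using finL by (simp add: P_def)
  have dist_le: "dist x \<le> walk_weight w' W" if "W \<in> P x" for x W
    unfolding dist_def using that finP by simp
  have "dist x \<le> w' x y + dist y" if xy: "x \<in> V" "y \<in> V" "x \<noteq> y" "E x y" for x y
  proof -
    have "[y] \<in> P y" using xy by (simp add: P_def L_def)
    then have "dist y \<in> walk_weight w' ` P y"
      unfolding dist_def using finP by (intro Min_in) auto
    then obtain W where W: "W \<in> P y" "dist y = walk_weight w' W" by blast
    from W(1) obtain W' where W': "W = y # W'"
      by (cases W) (auto simp: P_def)
    show ?thesis
    \<comment> \<open>A shortest walk from \<open>y\<close> is prolonged by \<open>x\<close>. If it
      already visits \<open>x\<close>, the cycle closed by the new step has positive weight and is
      cut off.\<close>
    proof (cases "x \<in> set W")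
      case False
      then have "x # W \<in> P x"
        using W(1) xy W' by (auto simp: P_def L_def)
      then show ?thesis using dist_le W W' by fastforce
    next
      case True
      then obtain c Q where cQ: "W = c @ x # Q" by (meson split_list)
      with W' xy have "c \<noteq> []" "hd c = y" by (cases c; simp)+
      have W_props: "set W \<subseteq> V" "distinct W" "successively E W"
        using W(1) by (auto simp: P_def L_def)
      then have "x # c \<in> C"
        using xy cQ \<open>c \<noteq> []\<close> \<open>hd c = y\<close>
        by (auto simp: C_def L_def successively_append_iff successively_Cons Suc_le_eq)
      then have "0 < walk_weight w' (x # c @ [x])"
        using e(2)[of "x # c"] by (simp add: w'_def walk_weight_diff_const)
      also have "walk_weight w' (x # c @ [x]) = w' x y + walk_weight w' (c @ [x])"
        using \<open>c \<noteq> []\<close> \<open>hd c = y\<close> by (cases c) auto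
      finally have "walk_weight w' (x # Q) \<le> w' x y + walk_weight w' W"
        using walk_weight_append[of w' c x Q] cQ by simp
      moreover have "x # Q \<in> P x"
        using W_props cQ by (auto simp: P_def L_def successively_append_iff)
      ultimately show ?thesis using dist_le W(2) by fastforce
    qed
  qed
  \<comment> \<open>The sign changes because \<open>dist\<close> measures walks leaving a vertex;
    subtracting \<open>e\<close> turns the weak inequality into a strict one.\<close>
  then show ?thesis
    using e(1) that[of "\<lambda>x. - dist x"] by (force simp: w'_def)
qed

section \<open>Bounds of paths\<close>

lemma dot_beta_plus_walk:
  "dot k (beta_plus_walk k a W) d = walk_weight (\<lambda>x y. dot k (beta_plus k a x y) d) W"
  unfolding dot_def beta_plus_walk_def walk_weight_def
  by (simp add: sum_distrib_right) (rule sum.swap)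

lemma dot_beta_minus_walk:
  "dot k (beta_minus_walk k a W) d = walk_weight (\<lambda>x y. dot k (beta_minus k a x y) d) W"
  unfolding dot_def beta_minus_walk_def walk_weight_def
  by (simp add: sum_distrib_right) (rule sum.swap)

lemma dot_chi [simp]: "dot k (chi i) d = (if i \<in> {1..k} then d i else 0)"
proof -
  have "dot k (chi i) d = (\<Sum>j\<in>{1..k}. if j = i then d j else 0)"
    unfolding dot_def chi_def by (intro sum.cong) auto
  then show ?thesis by simp
qed

lemma dot_uminus [simp]: "dot k (\<lambda>j. - b j) d = - dot k b d"
  by (simp add: dot_def sum_negf)

lemma dot_zero [simp]: "dot k (\<lambda>j. 0) d = 0"
  by (simp add: dot_def)

lemma dot_beta_plus_incr:
  assumes "a u v \<le> k" "0 < a u v"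
  shows "dot k (beta_plus_incr a u v) d = d (a u v)"
  using assms by (simp add: beta_plus_incr_def)

lemma dot_beta_minus_incr:
  assumes "a u v \<le> k"
  shows "dot k (beta_minus_incr k a u v) d = (if a u v < k then d (a u v + 1) else 0)"
  using assms by (simp add: beta_minus_incr_def)

lemma all_steps_iff_successively:
  "(\<forall>i\<in>{1..<length W}. P (W ! (i - 1)) (W ! i)) \<longleftrightarrow> successively P W"
proof -
  have "(\<forall>i\<in>{1..<length W}. P (W ! (i - 1)) (W ! i)) \<longleftrightarrow>
      (\<forall>i. Suc i < length W \<longrightarrow> P (W ! i) (W ! Suc i))"
    by (metis Suc_le_mono One_nat_def atLeastLessThan_iff diff_Suc_1 le0 not0_implies_Suc not_one_le_zero)
  then show ?thesis by (simp add: successively_conv_nth)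
qed

lemma upper_bound_path_iff:
  "upper_bound_path n a u v W \<longleftrightarrow> W \<noteq> [] \<and> set W \<subseteq> {1..n} \<and> hd W = u \<and> last W = v \<and>
     distinct W \<and> successively (\<lambda>x y. x < y \<longrightarrow> is_edge a x y) W"
  unfolding upper_bound_path_def upper_bound_walk_def is_walk_def
    all_steps_iff_successively[of W "\<lambda>x y. x < y \<longrightarrow> is_edge a x y"] by blast

lemma lower_bound_path_iff:
  "lower_bound_path n a u v W \<longleftrightarrow> W \<noteq> [] \<and> set W \<subseteq> {1..n} \<and> hd W = u \<and> last W = v \<and>
     distinct W \<and> successively (\<lambda>x y. y < x \<longrightarrow> is_edge a x y) W"
  unfolding lower_bound_path_def lower_bound_walk_def is_walk_def
    all_steps_iff_successively[of W "\<lambda>x y. y < x \<longrightarrow> is_edge a x y"] by blast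

section \<open>From increasing embeddings to path inequalities\<close>

text \<open>Both sides are compared with \<open>g v - g u\<close> by telescoping. Strictness comes
  from \<open>W2\<close>, which has an increasing step because \<open>u < v\<close>.\<close>

lemma path_inequality:
  fixes g :: "nat \<Rightarrow> real"
  assumes sym: "\<forall>u\<in>{1..n}. \<forall>v\<in>{1..n}. a u v = a v u"
    and le: "\<forall>u\<in>{1..n}. \<forall>v\<in>{1..n}. a u v \<le> k"
    and emb: "embeds_on k d a {1..n} g" and mono: "strict_mono_on {1..n} g"
    and "u < v" and W1: "upper_bound_path n a u v W1" and W2: "lower_bound_path n a u v W2"
  shows "dot k (beta_minus_walk k a W2) d < dot k (beta_plus_walk k a W1) d"
proof -
  have incr: "g x < g y" "in_class k d (a x y) (g y - g x)" "a x y \<le> k"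
    if "x \<in> {1..n}" "y \<in> {1..n}" "x < y" for x y
  proof -
    show "g x < g y" using strict_mono_onD[OF mono] that .
    then show "in_class k d (a x y) (g y - g x)"
      using emb that unfolding embeds_on_def by (metis abs_of_pos diff_gt_0_iff_gt)
    show "a x y \<le> k" using le that by blast
  qed
  have upper: "g y - g x \<le> dot k (beta_plus_incr a x y) d"
    if "x \<in> {1..n}" "y \<in> {1..n}" "x < y" "0 < a x y" for x y
    using incr[OF that(1-3)] that(4) by (simp add: in_class_def dot_beta_plus_incr)
  have lower: "dot k (beta_minus_incr k a x y) d < g y - g x"
    if "x \<in> {1..n}" "y \<in> {1..n}" "x < y" for x y
    using incr[OF that] by (simp add: in_class_def dot_beta_minus_incr)
  have "dot k (beta_minus_walk k a W2) d < g v - g u"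
  proof -
    have "successively (\<lambda>x y. dot k (beta_minus k a x y) d \<le> g y - g x \<and>
        (x < y \<longrightarrow> dot k (beta_minus k a x y) d < g y - g x)) W2"
    proof (rule successively_distinct_mono)
      show "successively (\<lambda>x y. y < x \<longrightarrow> is_edge a x y) W2" "distinct W2"
        using W2 by (simp_all add: lower_bound_path_iff)
      fix x y assume "x \<in> set W2" "y \<in> set W2" "x \<noteq> y" and E: "y < x \<longrightarrow> is_edge a x y"
      then have xy: "x \<in> {1..n}" "y \<in> {1..n}"
        using W2 by (auto simp: lower_bound_path_iff)
      show "dot k (beta_minus k a x y) d \<le> g y - g x \<and>
          (x < y \<longrightarrow> dot k (beta_minus k a x y) d < g y - g x)"
      proof (cases "x < y")
        case True
        then show ?thesis using lower[of x y] xy by (simp add: beta_minus_def)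
      next
        case False
        then have "y < x" using \<open>x \<noteq> y\<close> by simp
        then show ?thesis
          using E upper[of y x] xy sym by (auto simp: beta_minus_def is_edge_def)
      qed
    qed
    from walk_weight_lower[OF this] show ?thesis
      using W2 \<open>u < v\<close>
      by (auto simp: dot_beta_minus_walk lower_bound_path_iff)
  qed
  also have "g v - g u \<le> dot k (beta_plus_walk k a W1) d"
  proof -
    have "successively (\<lambda>x y. g y - g x \<le> dot k (beta_plus k a x y) d) W1"
    proof (rule successively_distinct_mono)
      show "successively (\<lambda>x y. x < y \<longrightarrow> is_edge a x y) W1" "distinct W1"
        using W1 by (simp_all add: upper_bound_path_iff)
      fix x y assume "x \<in> set W1" "y \<in> set W1" "x \<noteq> y" and E: "x < y \<longrightarrow> is_edge a x y"
      then have xy: "x \<in> {1..n}" "y \<in> {1..n}"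
        using W1 by (auto simp: upper_bound_path_iff)
      show "g y - g x \<le> dot k (beta_plus k a x y) d"
      proof (cases "x < y")
        case True
        then show ?thesis using E upper[of x y] xy by (simp add: beta_plus_def is_edge_def)
      next
        case False
        then have "y < x" using \<open>x \<noteq> y\<close> by simp
        then show ?thesis using lower[of y x] xy by (simp add: beta_plus_def)
      qed
    qed
    from walk_weight_upper[OF this] show ?thesis
      using W1 by (auto simp: dot_beta_plus_walk upper_bound_path_iff)
  qed
  finally show ?thesis .
qed

section \<open>From path inequalities to embeddings\<close>

text \<open>A cycle cut at \<open>u\<close> and \<open>v\<close> is an upper-bound-path out and a
  way back. Reversing the way back exchanges upper bounds with negated lower bounds, so it becomes a
  lower-bound-path of opposite weight.\<close>

lemma cycle_split:
  fixes u v n k :: nat and a :: "nat \<Rightarrow> nat \<Rightarrow> nat"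
  assumes sym: "\<forall>x\<in>{1..n}. \<forall>y\<in>{1..n}. a x y = a y x"
    and dist: "distinct (P @ [v])" "distinct (Q @ [u])"
    and P: "P \<noteq> []" "hd P = u" and Q: "Q \<noteq> []" "hd Q = v"
    and set: "set P \<subseteq> {1..n}" "set Q \<subseteq> {1..n}"
    and succ: "successively (\<lambda>x y. x < y \<longrightarrow> is_edge a x y) (P @ [v])"
      "successively (\<lambda>x y. x < y \<longrightarrow> is_edge a x y) (Q @ [u])"
  shows "upper_bound_path n a u v (P @ [v])" "lower_bound_path n a u v (rev (Q @ [u]))"
    "dot k (beta_minus_walk k a (rev (Q @ [u]))) d =
      - walk_weight (\<lambda>x y. dot k (beta_plus k a x y) d) (Q @ [u])"
proof -
  have uv: "u \<in> {1..n}" "v \<in> {1..n}"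
    using P Q set hd_in_set by blast+
  show "upper_bound_path n a u v (P @ [v])"
    using dist P uv set succ by (simp add: upper_bound_path_iff)
  have "successively (\<lambda>x y. x < y \<longrightarrow> is_edge a y x) (Q @ [u])"
  proof (rule successively_distinct_mono[OF succ(2) dist(2)])
    fix x y assume "x \<in> set (Q @ [u])" "y \<in> set (Q @ [u])" "x < y \<longrightarrow> is_edge a x y"
    moreover from this have "x \<in> {1..n}" "y \<in> {1..n}" using set uv by auto
    ultimately show "x < y \<longrightarrow> is_edge a y x"
      using sym by (auto simp: is_edge_def)
  qed
  moreover have "last (rev (Q @ [u])) = v"
    using Q by (simp add: last_rev)
  ultimately show "lower_bound_path n a u v (rev (Q @ [u]))"
    using dist uv set unfolding lower_bound_path_iff successively_rev by simp
  have "successively (\<lambda>x y. dot k (beta_minus k a y x) d = - dot k (beta_plus k a x y) d)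
      (Q @ [u])"
    by (rule successively_distinct_mono[OF succ(2) dist(2)])
      (auto simp: beta_minus_def beta_plus_def)
  then show "dot k (beta_minus_walk k a (rev (Q @ [u]))) d =
      - walk_weight (\<lambda>x y. dot k (beta_plus k a x y) d) (Q @ [u])"
    unfolding dot_beta_minus_walk by (rule walk_weight_rev)
qed

lemma embedding_of_path_inequalities:
  fixes n k :: nat and a :: "nat \<Rightarrow> nat \<Rightarrow> nat"
  assumes sym: "\<forall>u\<in>{1..n}. \<forall>v\<in>{1..n}. a u v = a v u"
    and le: "\<forall>u\<in>{1..n}. \<forall>v\<in>{1..n}. a u v \<le> k"
    and diag: "\<forall>u\<in>{1..n}. a u u = k"
    and d: "d \<in> DD k"
    and ineq: "\<And>u v W1 W2. u \<in> {1..n} \<Longrightarrow> v \<in> {1..n} \<Longrightarrow> u < v \<Longrightarrow>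
      upper_bound_path n a u v W1 \<Longrightarrow> lower_bound_path n a u v W2 \<Longrightarrow>
      dot k (beta_minus_walk k a W2) d < dot k (beta_plus_walk k a W1) d"
  obtains p where "embeds_on k d a {1..n} p"
proof -
  let ?E = "\<lambda>x y. x < y \<longrightarrow> is_edge a x y"
  let ?w = "\<lambda>x y. dot k (beta_plus k a x y) d"
  have split: "0 < walk_weight ?w (P @ [v]) + walk_weight ?w (Q @ [u])"
    if "u < v" "distinct (P @ [v])" "distinct (Q @ [u])" "P \<noteq> []" "hd P = u" "Q \<noteq> []" "hd Q = v"
      "set P \<subseteq> {1..n}" "set Q \<subseteq> {1..n}" "successively ?E (P @ [v])" "successively ?E (Q @ [u])"
    for u v P Q
  proof -
    have "u \<in> {1..n}" "v \<in> {1..n}"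
      using that hd_in_set by blast+
    then show ?thesis
      using ineq[OF _ _ that(1) cycle_split(1,2)[OF sym that(2-)]]
        cycle_split(3)[OF sym that(2-), of k d]
      by (simp add: dot_beta_plus_walk)
  qed
  have pos: "0 < walk_weight ?w (x # c @ [x])"
    if c: "c \<noteq> []" "distinct (x # c)" "set (x # c) \<subseteq> {1..n}" "successively ?E (x # c @ [x])" for x c
  proof -
    obtain y c' where c': "c = y # c'" using c(1) by (cases c) auto
    \<comment> \<open>The cycle is cut at its first two vertices; the smaller of them takes the role
      of \<open>u\<close> in \<open>split\<close>.\<close>
    have sum: "walk_weight ?w (x # c @ [x]) =
        walk_weight ?w ([x] @ [y]) + walk_weight ?w (c @ [x])"
      by (simp add: c')
    have succ: "successively ?E ([x] @ [y])" "successively ?E (c @ [x])"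
      using c(4) by (auto simp: c')
    have "x \<noteq> y" using c(2) by (simp add: c')
    then consider "x < y" | "y < x" by linarith
    then show ?thesis
    proof cases
      case 1
      then show ?thesis
        unfolding sum using c succ by (intro split) (auto simp: c')
    next
      case 2
      then show ?thesis
        unfolding sum using c succ
        by (subst add.commute, intro split) (auto simp: c')
    qed
  qed
  obtain p where p: "\<And>x y. x \<in> {1..n} \<Longrightarrow> y \<in> {1..n} \<Longrightarrow> x \<noteq> y \<Longrightarrow> ?E x y \<Longrightarrow>
      p y - p x < ?w x y"
    using strict_potential[of "{1..n}" ?E ?w] pos by blast
  have incr: "in_class k d (a u v) \<bar>p v - p u\<bar>" if uv: "u \<in> {1..n}" "v \<in> {1..n}" "u < v" for u v
  proof -
    have auv: "a u v \<le> k" using le uv by blast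
    have low: "(if a u v < k then d (a u v + 1) else 0) < p v - p u"
      using p[of v u] uv auv by (simp add: beta_plus_def dot_beta_minus_incr)
    \<comment> \<open>With a nonnegative lower bound \<open>p v - p u\<close> is positive and equals
      its absolute value.\<close>
    moreover have "0 \<le> (if a u v < k then d (a u v + 1) else 0)"
      using DD_pos[OF d, of "a u v + 1"] by auto
    moreover have "p v - p u < d (a u v)" if "0 < a u v"
      using p[of u v] uv auv that by (simp add: beta_plus_def dot_beta_plus_incr is_edge_def)
    ultimately show ?thesis by (auto simp: in_class_def split: if_splits)
  qed
  have "in_class k d (a u v) \<bar>p v - p u\<bar>" if uv: "u \<in> {1..n}" "v \<in> {1..n}" for u v
  proof -
    consider "u < v" | "u = v" | "v < u" by linarith
    then show ?thesis
    proof cases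
      case 1
      then show ?thesis using incr uv by blast
    next
      case 2
      \<comment> \<open>Distance zero falls in class \<open>k\<close>: for \<open>k > 0\<close>
        since \<open>d k\<close> is positive, for \<open>k = 0\<close> since both guards are
        void.\<close>
      then show ?thesis
        using diag uv DD_pos[OF d, of k] by (auto simp: in_class_def)
    next
      case 3
      then show ?thesis
        using incr[of v u] uv sym by (simp add: abs_minus_commute)
    qed
  qed
  then have "embeds_on k d a {1..n} p" by (simp add: embeds_on_def)
  then show ?thesis by (rule that)
qed

theorem theorem2:
  fixes n k :: nat and a :: "nat \<Rightarrow> nat \<Rightarrow> nat"
  assumes "robinson_matrix n a"
    and "\<forall>u\<in>{1..n}. \<forall>v\<in>{1..n}. a u v \<in> {0..k}"
    and "\<forall>u\<in>{1..n}. a u u = k"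
  shows "has_uniform_embedding n k a \<longleftrightarrow>
    (\<exists>d\<in>DD k. \<forall>u\<in>{1..n}. \<forall>v\<in>{1..n}. u < v \<longrightarrow>
       (\<forall>W1 W2. upper_bound_path n a u v W1 \<and> lower_bound_path n a u v W2 \<longrightarrow>
          dot k (beta_minus_walk k a W2) d < dot k (beta_plus_walk k a W1) d))"
    (is "_ \<longleftrightarrow> ?R")
proof
  have sym: "\<forall>u\<in>{1..n}. \<forall>v\<in>{1..n}. a u v = a v u"
    using assms(1) by (simp add: robinson_matrix_def)
  have le: "\<forall>u\<in>{1..n}. \<forall>v\<in>{1..n}. a u v \<le> k"
    using assms(2) by auto
  show ?R if emb: "has_uniform_embedding n k a"
    using increasing_embedding[OF assms(1,2) emb] path_inequality[OF sym le] by metis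
  show "has_uniform_embedding n k a" if ?R
  proof -
    from that obtain d where d: "d \<in> DD k"
      and ineq: "\<And>u v W1 W2. u \<in> {1..n} \<Longrightarrow> v \<in> {1..n} \<Longrightarrow> u < v \<Longrightarrow>
        upper_bound_path n a u v W1 \<Longrightarrow> lower_bound_path n a u v W2 \<Longrightarrow>
        dot k (beta_minus_walk k a W2) d < dot k (beta_plus_walk k a W1) d"
      by blast
    obtain p where "embeds_on k d a {1..n} p"
      by (rule embedding_of_path_inequalities[OF sym le assms(3) d ineq])
    then show ?thesis
      using d uniform_embedding_iff[OF d assms(2)] by (auto simp: has_uniform_embedding_def)
  qed
qed

end
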